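(* Let $\mathbb{K}\in\{\mathbb{R},\mathbb{C},\mathbb{H}\}$, let $G=O(n,\mathbb{K})$, let $X\in\mathcal{M}(n,\mathbb{K})$ be an arbitrary matrix, let $h_X\colon G\to\mathbb{R}$, $h_X(B)=\Re\mathrm{Tr}(XB)$, be the corresponding height function, and let $A\in G$ be a critical point of $h_X$. The solution $\alpha$ to the gradient equation $$\alpha'=\tfrac12\,(X^*-\alpha X\alpha)$$ passing through a given point $\alpha(0)\in\Omega_G(A)$ is the image by the generalized Cayley transform $c_{A^*}$ (that is, $\alpha=c_{A^*}\circ\beta$) of the curve in $T_{A^*}G$ defined as $$\beta(t)=\exp(-XAt/2)\cdot\beta_0\cdot\exp(-AXt/2),\qquad \beta_0=c_A(\alpha(0)).$$
   Context: $\mathcal{M}(n,\mathbb{K})$ is the space of $n\times n$ matrices over $\mathbb{K}$, and $A^*$ denotes the conjugate transpose. $O(n,\mathbb{K})=\{A\in\mathcal{M}(n,\mathbb{K})\colon AA^*=I\}$. The euclidean metric on $\mathcal{M}(n,\mathbb{K})$ is $\langle A,B\rangle=\Re\mathrm{Tr}(A^*B)$; with respect to the induced metric the gradient of $h_X$ on $G$ is $(\mathrm{grad}\,h_X)_A=\frac12(X^*-AXA)$. For $A\in G$, the tangent space is $T_AG=\{Y\in\mathcal{M}(n,\mathbb{K})\colon A^*Y+Y^*A=0\}$; $\Omega(A)$ is the open set of matrices $Y\in\mathcal{M}(n,\mathbb{K})$ such that $A+Y$ is invertible; $\Omega_G(A)=\Omega(A)\cap G$. The Cayley transform centered at $A$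 is the map $c_A\colon\Omega(A)\to\Omega(A^* )$, $c_A(Y)=(I-A^*Y)(A+Y)^{-1}$. *)

theory Defs
  imports "HOL-Analysis.Analysis"
begin

section \<open>Quaternions\<close>

datatype quat = Quat (qre: real) (qim1: real) (qim2: real) (qim3: real)

lemma quat_eq_iff:
  "x = y \<longleftrightarrow> qre x = qre y \<and> qim1 x = qim1 y \<and> qim2 x = qim2 y \<and> qim3 x = qim3 y"
  by (cases x; cases y) simp

instantiation quat :: real_div_algebra
begin

definition "0 = Quat 0 0 0 0"
definition "1 = Quat 1 0 0 0"
definition "x + y = Quat (qre x + qre y) (qim1 x + qim1 y) (qim2 x + qim2 y) (qim3 x + qim3 y)"
definition "x - y = Quat (qre x - qre y) (qim1 x - qim1 y) (qim2 x - qim2 y) (qim3 x - qim3 y)"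
definition "- x = Quat (- qre x) (- qim1 x) (- qim2 x) (- qim3 x)"
definition "scaleR r x = Quat (r * qre x) (r * qim1 x) (r * qim2 x) (r * qim3 x)"
definition "x * y = Quat
  (qre x * qre y - qim1 x * qim1 y - qim2 x * qim2 y - qim3 x * qim3 y)
  (qre x * qim1 y + qim1 x * qre y + qim2 x * qim3 y - qim3 x * qim2 y)
  (qre x * qim2 y - qim1 x * qim3 y + qim2 x * qre y + qim3 x * qim1 y)
  (qre x * qim3 y + qim1 x * qim2 y - qim2 x * qim1 y + qim3 x * qre y)"
definition "inverse x =
  (let N = (qre x)\<^sup>2 + (qim1 x)\<^sup>2 + (qim2 x)\<^sup>2 + (qim3 x)\<^sup>2
   in Quat (qre x / N) (- qim1 x / N) (- qim2 x / N) (- qim3 x / N))"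
definition "x div y = x * inverse y" for x y :: quat

lemmas quat_ring_defs = zero_quat_def one_quat_def plus_quat_def minus_quat_def
  uminus_quat_def scaleR_quat_def times_quat_def

instance
proof
  fix x y :: quat
  show "inverse x * x = 1" "x * inverse x = 1" if "x \<noteq> 0"
  proof -
    define N where "N = (qre x)\<^sup>2 + (qim1 x)\<^sup>2 + (qim2 x)\<^sup>2 + (qim3 x)\<^sup>2"
    have N: "N \<noteq> 0"
      using that by (auto simp: N_def quat_eq_iff zero_quat_def add_nonneg_eq_0_iff)
    have inv: "inverse x = Quat (qre x / N) (- qim1 x / N) (- qim2 x / N) (- qim3 x / N)"
      by (simp add: inverse_quat_def Let_def N_def)
    have sq: "qre x * qre x + qim1 x * qim1 x + qim2 x * qim2 x + qim3 x * qim3 x = N"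
      by (simp add: N_def power2_eq_square)
    show "inverse x * x = 1" "x * inverse x = 1"
      using N sq by (simp_all add: inv quat_eq_iff times_quat_def one_quat_def field_simps)
  qed
  show "x div y = x * inverse y" by (fact divide_quat_def)
  show "inverse (0::quat) = 0"
    by (simp add: quat_eq_iff inverse_quat_def Let_def zero_quat_def)
qed (simp_all add: quat_eq_iff quat_ring_defs algebra_simps)

end

lemma euler_four_squares:
  fixes a b c d e f g h :: real
  shows "(a * e - b * f - c * g - d * h)\<^sup>2 + (a * f + b * e + c * h - d * g)\<^sup>2 +
      (a * g - b * h + c * e + d * f)\<^sup>2 + (a * h + b * g - c * f + d * e)\<^sup>2 =
    (a\<^sup>2 + b\<^sup>2 + c\<^sup>2 + d\<^sup>2) * (e\<^sup>2 + f\<^sup>2 + g\<^sup>2 + h\<^sup>2)"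
  by (simp add: power2_eq_square algebra_simps)

instantiation quat :: "{real_normed_div_algebra, euclidean_space}"
begin

definition "inner x y = qre x * qre y + qim1 x * qim1 y + qim2 x * qim2 y + qim3 x * qim3 y"
definition "norm x = sqrt ((qre x)\<^sup>2 + (qim1 x)\<^sup>2 + (qim2 x)\<^sup>2 + (qim3 x)\<^sup>2)"
definition "sgn x = x /\<^sub>R norm x" for x :: quat
definition "dist x y = norm (x - y)" for x y :: quat
definition "(uniformity :: (quat \<times> quat) filter) =
  (INF e\<in>{0 <..}. principal {(x, y). dist x y < e})"
definition "open (U :: quat set) \<longleftrightarrow>
  (\<forall>x\<in>U. eventually (\<lambda>(x', y). x' = x \<longrightarrow> y \<in> U) uniformity)"
definition "Basis = {Quat 1 0 0 0, Quat 0 1 0 0, Quat 0 0 1 0, Quat 0 0 0 1}"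

instance
proof
  fix x y z :: quat and r :: real
  show inner_commute: "inner x y = inner y x" for x y :: quat
    by (simp add: inner_quat_def mult.commute)
  show inner_add: "inner (x + y) z = inner x z + inner y z" for x y z :: quat
    by (simp add: inner_quat_def plus_quat_def algebra_simps)
  show inner_scaleR: "inner (scaleR r x) y = r * inner x y" for x y :: quat and r
    by (simp add: inner_quat_def scaleR_quat_def algebra_simps)
  show "0 \<le> inner x x"
    by (simp add: inner_quat_def)
  show "inner x x = 0 \<longleftrightarrow> x = 0"
    by (simp add: inner_quat_def zero_quat_def quat_eq_iff add_nonneg_eq_0_iff)
  show norm_inner: "norm x = sqrt (inner x x)" for x :: quat
    by (simp add: inner_quat_def norm_quat_def power2_eq_square)
  show "(norm x = 0) = (x = 0)"
    by (simp add: norm_quat_def zero_quat_def quat_eq_iff add_nonneg_eq_0_iff)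
  show "norm (x * y) = norm x * norm y"
    by (simp only: norm_quat_def times_quat_def quat.sel euler_four_squares real_sqrt_mult)
  show "norm (scaleR r x) = \<bar>r\<bar> * norm x"
  proof -
    have "norm (scaleR r x) = sqrt (r\<^sup>2 * ((qre x)\<^sup>2 + (qim1 x)\<^sup>2 + (qim2 x)\<^sup>2 + (qim3 x)\<^sup>2))"
      by (simp add: norm_quat_def scaleR_quat_def power_mult_distrib distrib_left)
    then show ?thesis by (simp only: real_sqrt_mult norm_quat_def real_sqrt_abs)
  qed
  show "norm (x + y) \<le> norm x + norm y"
  proof -
    have "norm q = norm ((qre q, qim1 q), (qim2 q, qim3 q))" for q
      by (simp add: norm_quat_def norm_Pair add.assoc)
    then show ?thesis
      using norm_triangle_ineq[of "((qre x, qim1 x), (qim2 x, qim3 x))"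
          "((qre y, qim1 y), (qim2 y, qim3 y))"]
      by (simp add: plus_quat_def)
  qed
  show "(Basis :: quat set) \<noteq> {}" "finite (Basis :: quat set)"
    by (simp_all add: Basis_quat_def)
  show "inner u v = (if u = v then 1 else 0)" if "u \<in> Basis" "v \<in> Basis" for u v :: quat
    using that unfolding Basis_quat_def inner_quat_def
    by (elim insertE emptyE) simp_all
  show "(\<forall>u\<in>Basis. inner x u = 0) \<longleftrightarrow> x = 0"
    by (cases x) (simp add: Basis_quat_def inner_quat_def zero_quat_def)
qed (rule sgn_quat_def dist_quat_def open_quat_def uniformity_quat_def)+

end

section \<open>The scalars\<close>

text \<open>
  This class describes the three algebras of real numbers, complex numbers and quaternions
  uniformly, with their conjugation, real part and Euclidean inner product.  All three are
  instances, and by the theorem of Frobenius every instance is isomorphic to one of them.  The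
  isomorphism respects the additional structure, because conjugation and real part are determined
  by the norm and the multiplication.
\<close>

class rch_algebra = real_normed_div_algebra + euclidean_space +
  fixes conjg :: "'a \<Rightarrow> 'a"
    and repart :: "'a \<Rightarrow> real"
  assumes conjg_add: "conjg (x + y) = conjg x + conjg y"
    and conjg_mult: "conjg (x * y) = conjg y * conjg x"
    and conjg_conjg: "conjg (conjg x) = x"
    and mult_conjg: "x * conjg x = (norm x)\<^sup>2 *\<^sub>R 1"
    and add_conjg: "x + conjg x = (2 * repart x) *\<^sub>R 1"
    and inner_conjg: "inner x y = repart (conjg x * y)"

instantiation real :: rch_algebra
begin
definition "conjg x = x" for x :: real
definition "repart x = x" for x :: real
instance
  by standard (simp_all add: conjg_real_def repart_real_def power2_eq_square)
end

instantiation complex :: rch_algebra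
begin
definition "conjg x = cnj x" for x :: complex
definition "repart x = Re x" for x :: complex
instance
  by standard
    (simp_all add: conjg_complex_def repart_complex_def complex_eq_iff cmod_power2 inner_complex_def,
      simp_all add: power2_eq_square)
end

instantiation quat :: rch_algebra
begin
definition "conjg x = Quat (qre x) (- qim1 x) (- qim2 x) (- qim3 x)" for x :: quat
definition "repart x = qre x" for x :: quat
instance
proof
  fix x y :: quat
  show "conjg (x + y) = conjg x + conjg y"
    by (simp add: conjg_quat_def plus_quat_def)
  show "conjg (x * y) = conjg y * conjg x"
    by (simp add: conjg_quat_def times_quat_def)
  show "conjg (conjg x) = x"
    by (simp add: conjg_quat_def)
  show "x * conjg x = (norm x)\<^sup>2 *\<^sub>R 1"
    by (simp add: conjg_quat_def times_quat_def norm_quat_def scaleR_quat_def one_quat_def)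
      (simp add: power2_eq_square)
  show "x + conjg x = (2 * repart x) *\<^sub>R 1"
    by (simp add: conjg_quat_def plus_quat_def repart_quat_def scaleR_quat_def one_quat_def)
  show "inner x y = repart (conjg x * y)"
    by (simp add: conjg_quat_def times_quat_def repart_quat_def inner_quat_def)
qed
end

section \<open>Matrices\<close>

definition ctranspose :: "'k::rch_algebra^'n^'m \<Rightarrow> 'k^'m^'n" (\<open>_\<^sup>\<dagger>\<close> [1000] 999) where
  "A\<^sup>\<dagger> = (\<chi> i j. conjg (A $ j $ i))"

primrec mat_pow :: "'k::rch_algebra^'n^'n \<Rightarrow> nat \<Rightarrow> 'k^'n^'n" where
  "mat_pow M 0 = mat 1"
| "mat_pow M (Suc k) = M ** mat_pow M k"

text \<open>The library constant \<^const>\<open>exp\<close> does not apply: matrix multiplication is not the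
  ring multiplication of the type of square matrices.\<close>

definition mat_exp :: "'k::rch_algebra^'n^'n \<Rightarrow> 'k^'n^'n" where
  "mat_exp M = (\<Sum>k. mat_pow M k /\<^sub>R fact k)"

definition orth_group :: "('k::rch_algebra^'n^'n) set" where
  "orth_group = {A. A ** A\<^sup>\<dagger> = mat 1}"

definition tangent_space :: "'k::rch_algebra^'n^'n \<Rightarrow> ('k^'n^'n) set" where
  "tangent_space A = {Y. A\<^sup>\<dagger> ** Y + Y\<^sup>\<dagger> ** A = 0}"

definition height :: "'k::rch_algebra^'n^'n \<Rightarrow> 'k^'n^'n \<Rightarrow> real" where
  "height X B = repart (trace (X ** B))"

text \<open>Critical points of the restriction of \<^term>\<open>h\<close> to \<^const>\<open>orth_group\<close>: the
  differential of the restriction at \<^term>\<open>A\<close> is the restriction of the differential of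
  \<^term>\<open>h\<close> to the tangent space at \<^term>\<open>A\<close>.\<close>

definition critical_point :: "('k::rch_algebra^'n^'n \<Rightarrow> real) \<Rightarrow> 'k^'n^'n \<Rightarrow> bool" where
  "critical_point h A \<longleftrightarrow> A \<in> orth_group \<and>
     (\<exists>D. (h has_derivative D) (at A) \<and> (\<forall>Y\<in>tangent_space A. D Y = 0))"

text \<open>The equation \<open>\<alpha>' = grad h\<^sub>X\<close> on the group, for the height function \<open>h\<^sub>X\<close> and the metric
  induced by \<open>\<langle>A, B\<rangle> = Re Tr (A\<^sup>\<dagger> B)\<close>.\<close>

definition gradient_solution ::
    "'k::rch_algebra^'n^'n \<Rightarrow> real set \<Rightarrow> (real \<Rightarrow> 'k^'n^'n) \<Rightarrow> bool" where
  "gradient_solution X J \<alpha> \<longleftrightarrow> \<alpha> ` J \<subseteq> orth_group \<and>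
     (\<forall>t\<in>J. (\<alpha> has_vector_derivative (1/2) *\<^sub>R (X\<^sup>\<dagger> - \<alpha> t ** X ** \<alpha> t)) (at t within J))"

section \<open>The Cayley transform\<close>

definition Omega :: "'k::rch_algebra^'n^'n \<Rightarrow> ('k^'n^'n) set" where
  "Omega A = {Y. invertible (A + Y)}"

definition Omega_G :: "'k::rch_algebra^'n^'n \<Rightarrow> ('k^'n^'n) set" where
  "Omega_G A = Omega A \<inter> orth_group"

text \<open>Meaningful only for \<^term>\<open>Y \<in> Omega A\<close>, since otherwise \<^const>\<open>matrix_inv\<close> is
  unspecified.\<close>

definition cayley :: "'k::rch_algebra^'n^'n \<Rightarrow> 'k^'n^'n \<Rightarrow> 'k^'n^'n" where
  "cayley A Y = (mat 1 - A\<^sup>\<dagger> ** Y) ** matrix_inv (A + Y)"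

end

theory Submission
  imports Defs
begin

text \<open>
  With \<open>S = A \<beta>\<close>, which is skew-Hermitian exactly when \<open>\<beta>\<close> is tangent at \<open>A\<^sup>*\<close>, the Cayley
  transform becomes \<open>(2 R - 1) A\<close> for the resolvent \<open>R = (1 + S)\<^sup>-\<^sup>1\<close>.  Criticality of \<open>A\<close> makes
  \<open>Q = A X\<close> Hermitian, and conjugating \<open>exp (- X A t / 2)\<close> by \<open>A\<close> gives \<open>S t = E t S\<^sub>0 E t\<close> with
  \<open>E t = exp (- Q t / 2)\<close> Hermitian, so that \<open>S\<close> stays skew-Hermitian.  The gradient equation then
  follows from \<open>R' = - R S' R\<close>.  The difference \<open>d\<close> of two solutions satisfies the linear equation
  \<open>d' = - (d X \<alpha> + \<gamma> X d) / 2\<close> with bounded coefficients, so it vanishes by Gronwall.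
\<close>

subsection \<open>Conjugation and the matrix inner product\<close>

lemma conjg_one [simp]: "conjg (1::'k::rch_algebra) = 1"
  using mult_conjg[of "1::'k"] by simp

lemma repart_eq_inner: "repart x = inner 1 (x::'k::rch_algebra)"
  by (simp add: inner_conjg)

text \<open>Since \<open>repart\<close> is an inner product with 1, this reflection formula yields
  real homogeneity of the conjugation, for which the class axioms state additivity alone.\<close>

lemma conjg_eq: "conjg x = (2 * repart x) *\<^sub>R 1 - (x::'k::rch_algebra)"
  using add_conjg[of x] by (simp add: algebra_simps)

lemma conjg_scaleR: "conjg (r *\<^sub>R x) = r *\<^sub>R conjg (x::'k::rch_algebra)"
  by (simp add: conjg_eq repart_eq_inner algebra_simps)

lemma conjg_zero [simp]: "conjg (0::'k::rch_algebra) = 0"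
  using conjg_scaleR[of 0 "0::'k"] by simp

lemma conjg_sum: "conjg (\<Sum>i\<in>I. f i) = (\<Sum>i\<in>I. conjg (f i :: 'k::rch_algebra))"
  by (induction I rule: infinite_finite_induct) (simp_all add: conjg_add)

text \<open>The axiom \<open>mult_conjg\<close> has the factors in the other order. Multiplying by x
  on the left makes it applicable, and a nonzero x cancels.\<close>

lemma conjg_mult_self: "conjg x * x = (norm x)\<^sup>2 *\<^sub>R (1::'k::rch_algebra)"
proof (cases "x = 0")
  case False
  have "x * (conjg x * x) = x * ((norm x)\<^sup>2 *\<^sub>R 1)"
    using mult_conjg[of x] by (simp flip: mult.assoc)
  with False show ?thesis by (simp only: mult_cancel_left) simp
qed simp

lemma norm_conjg [simp]: "norm (conjg x) = norm (x::'k::rch_algebra)"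
proof -
  have "(norm (conjg x))\<^sup>2 *\<^sub>R (1::'k) = (norm x)\<^sup>2 *\<^sub>R 1"
    using mult_conjg[of "conjg x"] conjg_mult_self[of x] by (simp add: conjg_conjg)
  then show ?thesis by simp
qed

lemma ctranspose_nth [simp]: "A\<^sup>\<dagger> $ i $ j = conjg (A $ j $ i)"
  by (simp add: ctranspose_def)

lemma ctranspose_ctranspose [simp]: "(A\<^sup>\<dagger>)\<^sup>\<dagger> = A"
  by (simp add: vec_eq_iff conjg_conjg)

lemma ctranspose_add: "(A + B)\<^sup>\<dagger> = A\<^sup>\<dagger> + B\<^sup>\<dagger>"
  by (simp add: vec_eq_iff conjg_add)

lemma ctranspose_scaleR: "(r *\<^sub>R A)\<^sup>\<dagger> = r *\<^sub>R A\<^sup>\<dagger>"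
  by (simp add: vec_eq_iff conjg_scaleR)

lemma ctranspose_minus: "(- A)\<^sup>\<dagger> = - A\<^sup>\<dagger>"
  using ctranspose_scaleR[of "-1" A] by simp

lemma ctranspose_diff: "(A - B)\<^sup>\<dagger> = A\<^sup>\<dagger> - B\<^sup>\<dagger>"
  using ctranspose_add[of A "- B"] by (simp add: ctranspose_minus)

lemma ctranspose_mult: "(A ** B)\<^sup>\<dagger> = B\<^sup>\<dagger> ** A\<^sup>\<dagger>"
  by (simp add: vec_eq_iff matrix_matrix_mult_def conjg_sum conjg_mult)

lemma ctranspose_mat_one [simp]: "(mat 1)\<^sup>\<dagger> = mat 1"
  by (simp add: vec_eq_iff mat_def)

lemmas ctranspose_simps =
  ctranspose_add ctranspose_minus ctranspose_diff ctranspose_scaleR ctranspose_mult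

lemma norm_ctranspose: "norm (A\<^sup>\<dagger>) = norm (A::'k::rch_algebra^'n^'n)"
proof -
  have "inner (A\<^sup>\<dagger>) (A\<^sup>\<dagger>) = inner A A"
    unfolding inner_vec_def
    by (subst sum.swap) (simp add: dot_square_norm)
  then show ?thesis
    by (simp add: norm_eq_sqrt_inner)
qed

text \<open>Polarization of \<open>norm_ctranspose\<close>.\<close>

lemma inner_ctranspose: "inner (A\<^sup>\<dagger>) (B\<^sup>\<dagger>) = inner A (B::'k::rch_algebra^'n^'n)"
  by (simp add: dot_norm norm_ctranspose flip: ctranspose_add)

lemma bounded_linear_ctranspose:
  "bounded_linear (ctranspose :: 'k::rch_algebra^'n^'n \<Rightarrow> 'k^'n^'n)"
  by (rule bounded_linear_intro[where K = 1])
    (simp_all add: ctranspose_add ctranspose_scaleR norm_ctranspose)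

lemma repart_sum: "repart (\<Sum>i\<in>I. f i) = (\<Sum>i\<in>I. repart (f i :: 'k::rch_algebra))"
  by (simp add: repart_eq_inner inner_sum_right)

text \<open>Identifies the entrywise inner product of the matrix type with the metric Re Tr(A* B),
  so that facts about Euclidean spaces apply to it.\<close>

lemma inner_eq_repart_trace:
  "inner A B = repart (trace (A\<^sup>\<dagger> ** (B::'k::rch_algebra^'n^'n)))"
  unfolding inner_vec_def trace_def matrix_matrix_mult_def
  by (subst sum.swap) (simp add: repart_sum inner_conjg)

lemma inner_matrix_adjoint:
  fixes A B C :: "'k::rch_algebra^'n^'n"
  shows "inner A (B ** C) = inner (B\<^sup>\<dagger> ** A) C"
  by (simp add: inner_eq_repart_trace ctranspose_mult matrix_mul_assoc)

text \<open>Moving S to the other side of the real inner product changes the sign, while symmetry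
  preserves the value.\<close>

lemma inner_mult_skew:
  fixes S C :: "'k::rch_algebra^'n^'n"
  assumes "S\<^sup>\<dagger> = - S"
  shows "inner C (S ** C) = 0"
proof -
  have "(- S) ** C = - (S ** C)"
    by (simp add: vec_eq_iff matrix_matrix_mult_def sum_negf)
  then have "inner C (S ** C) = - inner C (S ** C)"
    using inner_matrix_adjoint[of C S C] by (simp add: assms inner_commute)
  then show ?thesis by simp
qed

section \<open>The matrix product as a bounded bilinear map, and inverses\<close>

lemma bounded_bilinear_matrix_mult:
  "bounded_bilinear ((**) :: 'k::rch_algebra^'n^'n \<Rightarrow> 'k^'n^'n \<Rightarrow> 'k^'n^'n)"
proof -
  have "bilinear ((**) :: 'k^'n^'n \<Rightarrow> 'k^'n^'n \<Rightarrow> 'k^'n^'n)"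
    by (simp add: bilinear_def linear_iff matrix_add_ldistrib vec_eq_iff matrix_matrix_mult_def
        scaleR_sum_right sum.distrib distrib_right distrib_left)
  then show ?thesis by (simp add: bilinear_conv_bounded_bilinear)
qed

interpretation matrix_mult:
  bounded_bilinear "(**) :: 'k::rch_algebra^'n^'n \<Rightarrow> 'k^'n^'n \<Rightarrow> 'k^'n^'n"
  by (rule bounded_bilinear_matrix_mult)

lemmas matrix_ring_simps =
  matrix_mult.add_left matrix_mult.add_right matrix_mult.diff_left matrix_mult.diff_right
  matrix_mult.minus_left matrix_mult.minus_right matrix_mult.scaleR_left matrix_mult.scaleR_right
  matrix_mul_assoc

text \<open>Determinants are avoided because the scalars may be quaternions. Right multiplication by
  A is real linear and injective, as right multiplication by B undoes it; in finite dimension it is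
  onto, so A has a left inverse, which must equal B.\<close>

lemma matrix_mult_eq_one_commute:
  fixes A B :: "'k::rch_algebra^'n^'n"
  assumes "A ** B = mat 1"
  shows "B ** A = mat 1"
proof -
  have lin: "linear (\<lambda>C :: 'k^'n^'n. C ** A)"
    by (rule bounded_linear.linear) (rule matrix_mult.bounded_linear_left)
  have "inj (\<lambda>C :: 'k^'n^'n. C ** A)"
    by (rule inj_on_inverseI[where g = "\<lambda>C. C ** B"]) (simp add: assms flip: matrix_mul_assoc)
  with lin have "surj (\<lambda>C :: 'k^'n^'n. C ** A)"
    by (simp add: linear_injective_imp_surjective)
  then obtain C where C: "C ** A = mat 1"
    by (metis surjD)
  then have "C = B"
    by (metis assms matrix_mul_assoc matrix_mul_lid matrix_mul_rid)
  with C show ?thesis by simp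
qed

lemma matrix_inv_eqI:
  fixes A B :: "'k::rch_algebra^'n^'n"
  assumes "A ** B = mat 1"
  shows "matrix_inv A = B"
proof -
  have "B ** A = mat 1" using assms by (rule matrix_mult_eq_one_commute)
  with assms have "\<exists>B. A ** B = mat 1 \<and> B ** A = mat 1" by (intro exI conjI)
  then have "A ** matrix_inv A = mat 1 \<and> matrix_inv A ** A = mat 1"
    unfolding matrix_inv_def by (rule someI_ex)
  with \<open>B ** A = mat 1\<close> show ?thesis
    by (metis matrix_mul_assoc matrix_mul_lid matrix_mul_rid)
qed

text \<open>By \<open>inner_mult_skew\<close>, pairing C with \<open>(mat 1 + S) ** C\<close> gives
  the squared norm of C. Left multiplication by 1 + S is therefore injective and, by dimension,
  onto.\<close>

lemma skew_plus_one_inverse: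
  fixes S :: "'k::rch_algebra^'n^'n"
  assumes "S\<^sup>\<dagger> = - S"
  obtains R where "(mat 1 + S) ** R = mat 1" "R ** (mat 1 + S) = mat 1"
proof -
  have lin: "linear (\<lambda>C :: 'k^'n^'n. (mat 1 + S) ** C)"
    by (rule bounded_linear.linear) (rule matrix_mult.bounded_linear_right)
  have "C = 0" if "(mat 1 + S) ** C = 0" for C :: "'k^'n^'n"
  proof -
    have "inner C ((mat 1 + S) ** C) = inner C C"
      by (simp add: matrix_mult.add_left inner_add_right inner_mult_skew[OF assms])
    with that show ?thesis by simp
  qed
  with lin have "surj (\<lambda>C :: 'k^'n^'n. (mat 1 + S) ** C)"
    by (simp add: linear_injective_imp_surjective linear_injective_0)
  then obtain R where "(mat 1 + S) ** R = mat 1"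
    by (metis surjD)
  with that show thesis by (blast intro: matrix_mult_eq_one_commute)
qed

text \<open>The group lies on a sphere about 0; this bounds the resolvent and the coefficients of
  the uniqueness estimate.\<close>

lemma norm_orth_group:
  fixes A :: "'k::rch_algebra^'n^'n"
  assumes "A \<in> orth_group"
  shows "norm A = norm (mat 1 :: 'k^'n^'n)"
proof -
  have "A\<^sup>\<dagger> ** A = mat 1"
    using assms by (auto simp: orth_group_def intro: matrix_mult_eq_one_commute)
  then have "inner A A = inner (mat 1 :: 'k^'n^'n) (mat 1)"
    by (simp add: inner_eq_repart_trace)
  then show ?thesis by (simp add: norm_eq_sqrt_inner)
qed

subsection \<open>The matrix exponential\<close>

lemma mat_pow_bound:
  "\<exists>c d. \<forall>k. norm (mat_pow (M::'k::rch_algebra^'n^'n) k) \<le> c * d ^ k"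
proof -
  obtain K where K: "0 < K"
    "\<And>(A :: 'k^'n^'n) (B :: 'k^'n^'n). norm (A ** B) \<le> norm A * norm B * K"
    using matrix_mult.pos_bounded by blast
  \<comment> \<open>The constant K of the bilinear bound is absorbed into the ratio, one factor per
    multiplication.\<close>
  have "norm (mat_pow M k) \<le> norm (mat 1 :: 'k^'n^'n) * (norm M * K) ^ k" for k
  proof (induction k)
    case (Suc k)
    have "norm (mat_pow M (Suc k)) \<le> norm M * norm (mat_pow M k) * K"
      using K(2) by simp
    also have "\<dots> \<le> norm M * (norm (mat 1 :: 'k^'n^'n) * (norm M * K) ^ k) * K"
      using Suc K(1) by (intro mult_left_mono mult_right_mono) auto
    finally show ?case by (simp add: mult_ac)
  qed simp
  then show ?thesis by blast
qed

lemma summable_mat_exp: "summable (\<lambda>k. mat_pow (M::'k::rch_algebra^'n^'n) k /\<^sub>R fact k)"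
proof -
  obtain c d where cd: "\<And>k. norm (mat_pow M k) \<le> c * d ^ k"
    using mat_pow_bound by blast
  show ?thesis
  proof (rule summable_comparison_test'[where N = 0])
    show "summable (\<lambda>k. c * (inverse (fact k) * d ^ k))"
      by (intro summable_mult summable_exp)
    show "norm (mat_pow M k /\<^sub>R fact k) \<le> c * (inverse (fact k) * d ^ k)" for k
      using cd[of k] by (simp add: divide_simps)
  qed
qed

lemma mat_pow_scaleR: "mat_pow (t *\<^sub>R M) k = t ^ k *\<^sub>R mat_pow (M::'k::rch_algebra^'n^'n) k"
  by (induction k) (simp_all add: matrix_ring_simps)

lemma mat_exp_zero [simp]: "mat_exp (0::'k::rch_algebra^'n^'n) = mat 1"
proof -
  have "mat_pow (0::'k^'n^'n) k = (if k = 0 then mat 1 else 0)" for k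
    by (induction k) simp_all
  then have "mat_exp (0::'k^'n^'n) = (\<Sum>k. if k = 0 then mat 1 else 0)"
    unfolding mat_exp_def by (intro suminf_cong) auto
  also have "\<dots> = mat 1"
    using sums_single[of 0 "\<lambda>_. mat 1 :: 'k^'n^'n"] by (simp add: sums_iff)
  finally show ?thesis .
qed

text \<open>The relation passes to powers and then, by continuity of both multiplications, to the
  series. It serves to move A past an exponential and, with \<open>P = Q\<close>, to commute M with
  its exponential.\<close>

lemma mat_exp_intertwine:
  fixes A P Q :: "'k::rch_algebra^'n^'n"
  assumes "A ** P = Q ** A"
  shows "A ** mat_exp P = mat_exp Q ** A"
proof -
  have pow: "A ** mat_pow P k = mat_pow Q k ** A" for k
    by (induction k) (simp_all add: assms matrix_mul_assoc, simp add: assms flip: matrix_mul_assoc)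
  have "A ** mat_exp P = (\<Sum>k. A ** (mat_pow P k /\<^sub>R fact k))"
    unfolding mat_exp_def
    by (rule bounded_linear.suminf[OF matrix_mult.bounded_linear_right summable_mat_exp])
  also have "\<dots> = (\<Sum>k. (mat_pow Q k /\<^sub>R fact k) ** A)"
    by (simp add: matrix_mult.scaleR_left matrix_mult.scaleR_right pow)
  also have "\<dots> = mat_exp Q ** A"
    unfolding mat_exp_def
    by (rule bounded_linear.suminf[OF matrix_mult.bounded_linear_left summable_mat_exp, symmetric])
  finally show ?thesis .
qed

lemma ctranspose_mat_exp:
  fixes M :: "'k::rch_algebra^'n^'n"
  shows "(mat_exp M)\<^sup>\<dagger> = mat_exp (M\<^sup>\<dagger>)"
proof -
  \<comment> \<open>Transposition reverses the product in the recursion of \<open>mat_pow\<close>;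
    this restores the order.\<close>
  have comm: "M ** mat_pow M k = mat_pow M k ** M" for M :: "'k^'n^'n" and k
    by (induction k) (simp_all, simp add: matrix_mul_assoc)
  have pow: "(mat_pow M k)\<^sup>\<dagger> = mat_pow (M\<^sup>\<dagger>) k" for k
    by (induction k) (simp_all add: ctranspose_mult comm)
  have "(mat_exp M)\<^sup>\<dagger> = (\<Sum>k. (mat_pow M k /\<^sub>R fact k)\<^sup>\<dagger>)"
    unfolding mat_exp_def
    by (rule bounded_linear.suminf[OF bounded_linear_ctranspose summable_mat_exp])
  then show ?thesis
    by (simp add: ctranspose_scaleR pow mat_exp_def)
qed

text \<open>Each coordinate of the exponential is a real power series in t that converges
  everywhere, so it may be differentiated term by term.\<close>

lemma mat_exp_has_vector_derivative:
  fixes M :: "'k::rch_algebra^'n^'n"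
  shows "((\<lambda>t. mat_exp (t *\<^sub>R M)) has_vector_derivative M ** mat_exp (t *\<^sub>R M)) (at t)"
  unfolding has_vector_derivative_def
proof (subst has_derivative_componentwise_within, intro ballI)
  fix b :: "'k^'n^'n"
  define c where "c k = (mat_pow M k \<bullet> b) / fact k" for k
  have term_eq: "(mat_pow (x *\<^sub>R M) k /\<^sub>R fact k) \<bullet> b = c k * x ^ k" for x k
    by (simp add: c_def mat_pow_scaleR divide_inverse mult_ac)
  have sums: "(\<lambda>k. c k * x ^ k) sums (mat_exp (x *\<^sub>R M) \<bullet> b)" for x
    using bounded_linear.sums[OF bounded_linear_inner_left[of b]
        summable_sums[OF summable_mat_exp[of "x *\<^sub>R M"]]]
    by (simp only: term_eq mat_exp_def)
  \<comment> \<open>Index shift: the factor k + 1 cancels against the factorial of k + 1, and the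
    power of index k + 1 splits off one M.\<close>
  have "diffs c k * x ^ k = (M ** (mat_pow (x *\<^sub>R M) k /\<^sub>R fact k)) \<bullet> b" for x k
    by (simp add: diffs_def c_def mat_pow_scaleR matrix_mult.scaleR_right divide_inverse
        nonzero_inverse_mult_distrib del: of_nat_Suc)
  then have diffs: "(\<lambda>k. diffs c k * x ^ k) sums ((M ** mat_exp (x *\<^sub>R M)) \<bullet> b)" for x
    using bounded_linear.sums[OF bounded_linear_inner_left[of b] bounded_linear.sums[OF
          matrix_mult.bounded_linear_right summable_sums[OF summable_mat_exp[of "x *\<^sub>R M"]]]]
    by (simp only: mat_exp_def)
  have "((\<lambda>x. \<Sum>k. c k * x ^ k) has_field_derivative (\<Sum>k. diffs c k * t ^ k)) (at t)"
    using sums by (intro termdiffs_strong_converges_everywhere) (rule sums_summable)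
  then have "((\<lambda>x. mat_exp (x *\<^sub>R M) \<bullet> b) has_field_derivative (M ** mat_exp (t *\<^sub>R M)) \<bullet> b) (at t)"
    using sums_unique[OF sums] sums_unique[OF diffs] by simp
  then show "((\<lambda>x. mat_exp (x *\<^sub>R M) \<bullet> b) has_derivative
      (\<lambda>h. h *\<^sub>R (M ** mat_exp (t *\<^sub>R M)) \<bullet> b)) (at t)"
    by (simp add: has_field_derivative_def mult_commute_abs)
qed

subsection \<open>Curves of matrices\<close>

lemma has_vector_derivative_iff_slope:
  "(f has_vector_derivative D) (at t) \<longleftrightarrow> ((\<lambda>s. (f s - f t) /\<^sub>R (s - t)) \<longlongrightarrow> D) (at t)"
proof -
  have eq: "norm (f s - f t - (s - t) *\<^sub>R D) / norm (s - t) = norm ((f s - f t) /\<^sub>R (s - t) - D)"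
    if "s \<noteq> t" for s
  proof -
    have "(f s - f t) /\<^sub>R (s - t) - D = (f s - f t - (s - t) *\<^sub>R D) /\<^sub>R (s - t)"
      using that by (simp add: scaleR_diff_right)
    then show ?thesis by (simp add: divide_inverse mult.commute)
  qed
  have "(f has_vector_derivative D) (at t) \<longleftrightarrow>
      ((\<lambda>s. norm (f s - f t - (s - t) *\<^sub>R D) / norm (s - t)) \<longlongrightarrow> 0) (at t)"
    by (simp add: has_vector_derivative_def has_derivative_iff_norm bounded_linear_scaleR_left)
  also have "\<dots> \<longleftrightarrow> ((\<lambda>s. norm ((f s - f t) /\<^sub>R (s - t) - D)) \<longlongrightarrow> 0) (at t)"
    by (intro tendsto_cong, unfold eventually_at_filter) (intro always_eventually allI impI eq)
  finally show ?thesis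
    by (simp add: tendsto_norm_zero_iff LIM_zero_iff)
qed

text \<open>The resolvent identity R(s) - R(t) = - R(s) (S(s) - S(t)) R(t) first shows that R is
  continuous at t, thanks to the uniform bound; dividing it by s - t then gives the
  derivative.\<close>

lemma resolvent_has_vector_derivative:
  fixes S R :: "real \<Rightarrow> 'k::rch_algebra^'n^'n"
  assumes S: "(S has_vector_derivative S') (at t)"
    and left: "\<And>s. R s ** (mat 1 + S s) = mat 1"
    and right: "\<And>s. (mat 1 + S s) ** R s = mat 1"
    and bound: "\<And>s. norm (R s) \<le> K"
  shows "(R has_vector_derivative - (R t ** S' ** R t)) (at t)"
proof -
  have diff: "R s - R t = - (R s ** (S s - S t) ** R t)" for s
  proof -
    have "R s ** ((mat 1 + S s) - (mat 1 + S t)) ** R t =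
        (R s ** (mat 1 + S s)) ** R t - R s ** ((mat 1 + S t) ** R t)"
      by (simp only: matrix_mult.diff_left matrix_mult.diff_right matrix_mul_assoc)
    then show ?thesis by (simp add: left right)
  qed
  have "(S \<longlongrightarrow> S t) (at t)"
    using S by (auto simp: isCont_def dest: has_vector_derivative_continuous)
  \<comment> \<open>Continuity of R is not yet known, so the product is handled as a bounded factor
    times a null one.\<close>
  then have "Zfun (\<lambda>s. R s ** (S s - S t)) (at t)"
    by (intro matrix_mult.Bfun_prod_Zfun BfunI[where K = K])
      (simp_all add: tendsto_Zfun_iff bound)
  then have "((\<lambda>s. R s ** (S s - S t)) \<longlongrightarrow> 0) (at t)"
    by (simp add: tendsto_Zfun_iff)
  then have "((\<lambda>s. - (R s ** (S s - S t) ** R t)) \<longlongrightarrow> - (0 ** R t)) (at t)"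
    by (intro tendsto_intros matrix_mult.tendsto)
  then have "((\<lambda>s. R s - R t) \<longlongrightarrow> 0) (at t)"
    by (simp only: diff times0_left minus_zero)
  then have R: "(R \<longlongrightarrow> R t) (at t)"
    by (rule LIM_zero_cancel)
  have "((\<lambda>s. - (R s ** ((S s - S t) /\<^sub>R (s - t)) ** R t)) \<longlongrightarrow> - (R t ** S' ** R t)) (at t)"
    using S by (intro tendsto_intros matrix_mult.tendsto R) (simp add: has_vector_derivative_iff_slope)
  then show ?thesis
    by (simp add: has_vector_derivative_iff_slope diff matrix_mult.scaleR_left
        matrix_mult.scaleR_right)
qed

section \<open>Uniqueness of solutions by a Gronwall estimate\<close>

lemma zero_of_linear_growth_right:
  fixes d d' :: "real \<Rightarrow> 'a::real_inner"
  assumes "0 \<le> b" and "d 0 = 0"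
    and deriv: "\<And>t. t \<in> {0..b} \<Longrightarrow> (d has_vector_derivative d' t) (at t within {0..b})"
    and growth: "\<And>t. t \<in> {0..b} \<Longrightarrow> norm (d' t) \<le> C * norm (d t)"
  shows "d b = 0"
proof -
  \<comment> \<open>The integrating factor turns the estimate (|d|^2)' <= 2 C |d|^2 into
    monotonicity: f is nonincreasing, nonnegative and zero at 0.\<close>
  define f where "f t = exp (- (2 * C) * t) * (d t \<bullet> d t)" for t
  have f': "(f has_real_derivative
      exp (- (2 * C) * t) * (2 * (d t \<bullet> d' t)) - 2 * C * exp (- (2 * C) * t) * (d t \<bullet> d t))
      (at t within {0..b})" if "t \<in> {0..b}" for t
  proof -
    have "((\<lambda>t. d t \<bullet> d t) has_real_derivative 2 * (d t \<bullet> d' t)) (at t within {0..b})"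
      using bounded_bilinear.has_vector_derivative[OF bounded_bilinear_inner
          deriv[OF that] deriv[OF that]]
      by (simp add: has_real_derivative_iff_has_vector_derivative inner_commute)
    then show ?thesis
      unfolding f_def by (auto intro!: derivative_eq_intros simp: algebra_simps)
  qed
  have le: "d t \<bullet> d' t \<le> C * (d t \<bullet> d t)" if "t \<in> {0..b}" for t
  proof -
    have "d t \<bullet> d' t \<le> norm (d t) * norm (d' t)"
      by (rule norm_cauchy_schwarz)
    also have "\<dots> \<le> norm (d t) * (C * norm (d t))"
      using growth[OF that] by (rule mult_left_mono) simp
    finally show ?thesis
      by (simp add: dot_square_norm power2_eq_square mult_ac)
  qed
  have "f b \<le> f 0"
  proof (rule DERIV_nonpos_imp_decreasing_open[OF \<open>0 \<le> b\<close>])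
    fix t assume t: "0 < t" "t < b"
    then have "(f has_real_derivative
        exp (- (2 * C) * t) * (2 * (d t \<bullet> d' t)) - 2 * C * exp (- (2 * C) * t) * (d t \<bullet> d t)) (at t)"
      using f'[of t] by (simp add: at_within_Icc_at)
    moreover have "exp (- (2 * C) * t) * (d t \<bullet> d' t) \<le> exp (- (2 * C) * t) * (C * (d t \<bullet> d t))"
      using le[of t] t by (intro mult_left_mono) auto
    ultimately show "\<exists>y. DERIV f t :> y \<and> y \<le> 0"
      by (intro exI conjI) (assumption, simp add: algebra_simps)
  next
    show "continuous_on {0..b} f"
      using f' by (rule DERIV_continuous_on)
  qed
  then have "f b \<le> 0"
    using \<open>d 0 = 0\<close> by (simp add: f_def)
  then have "d b \<bullet> d b \<le> 0"
    by (simp add: f_def mult_le_0_iff)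
  then show ?thesis
    by (metis inner_ge_zero inner_eq_zero_iff order_antisym)
qed

text \<open>Times before 0 are reached by reversing time, which preserves the growth bound. An
  interval containing 0 and b contains the segment between them.\<close>

lemma zero_of_linear_growth:
  fixes d d' :: "real \<Rightarrow> 'a::real_inner"
  assumes "is_interval J" "0 \<in> J" "d 0 = 0"
    and deriv: "\<And>t. t \<in> J \<Longrightarrow> (d has_vector_derivative d' t) (at t within J)"
    and growth: "\<And>t. t \<in> J \<Longrightarrow> norm (d' t) \<le> C * norm (d t)"
    and "b \<in> J"
  shows "d b = 0"
proof (cases "0 \<le> b")
  case True
  then have sub: "{0..b} \<subseteq> J"
    using assms(1,2,6) by (meson atLeastAtMost_iff mem_is_interval_1_I subsetI)
  show ?thesis
  proof (rule zero_of_linear_growth_right[where d = d and d' = d', OF True \<open>d 0 = 0\<close>])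
    fix t assume "t \<in> {0..b}"
    with sub have "t \<in> J" by blast
    then show "(d has_vector_derivative d' t) (at t within {0..b})"
      "norm (d' t) \<le> C * norm (d t)"
      using sub by (blast intro: has_vector_derivative_within_subset[OF deriv] growth)+
  qed
next
  case False
  then have sub: "{b..0} \<subseteq> J"
    using assms(1,2,6) by (meson atLeastAtMost_iff mem_is_interval_1_I subsetI)
  have img: "uminus ` {0..- b} = {b..0}"
    by simp
  \<comment> \<open>The double sign is the value of the reversed curve at its right endpoint
    \<open>- b\<close>.\<close>
  have "d (- (- b)) = 0"
  proof (rule zero_of_linear_growth_right[where d = "\<lambda>t. d (- t)" and d' = "\<lambda>t. - d' (- t)"])
    fix t assume "t \<in> {0..- b}"
    then have minus_in: "- t \<in> J"
      by (intro subsetD[OF sub]) auto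
    have "(d has_vector_derivative d' (- t)) (at (- t) within uminus ` {0..- b})"
      unfolding img by (rule has_vector_derivative_within_subset[OF deriv[OF minus_in] sub])
    then show "((\<lambda>t. d (- t)) has_vector_derivative - d' (- t)) (at t within {0..- b})"
      using vector_diff_chain_within[OF has_vector_derivative_minus[OF has_vector_derivative_id]]
      by (fastforce simp: o_def)
    show "norm (- d' (- t)) \<le> C * norm (d (- t))"
      using growth[OF minus_in] by simp
  qed (use False \<open>d 0 = 0\<close> in auto)
  then show ?thesis by simp
qed

lemma gradient_solution_unique:
  fixes \<alpha> \<gamma> :: "real \<Rightarrow> 'k::rch_algebra^'n^'n"
  assumes J: "is_interval J" "0 \<in> J" "t \<in> J"
    and \<alpha>: "gradient_solution X J \<alpha>" and \<gamma>: "gradient_solution X J \<gamma>"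
    and init: "\<alpha> 0 = \<gamma> 0"
  shows "\<alpha> t = \<gamma> t"
proof -
  define c where "c = norm (mat 1 :: 'k^'n^'n)"
  obtain K where K: "0 < K"
    "\<And>(A :: 'k^'n^'n) (B :: 'k^'n^'n). norm (A ** B) \<le> norm A * norm B * K"
    using matrix_mult.pos_bounded by blast
  have K3: "norm (A ** B ** C) \<le> norm A * norm B * norm C * K\<^sup>2" for A B C :: "'k^'n^'n"
  proof -
    have "norm (A ** B ** C) \<le> norm (A ** B) * norm C * K"
      by (rule K(2))
    also have "\<dots> \<le> (norm A * norm B * K) * norm C * K"
      using K by (intro mult_right_mono) auto
    finally show ?thesis by (simp add: power2_eq_square mult_ac)
  qed
  have bound: "norm (\<alpha> s) = c" "norm (\<gamma> s) = c" if "s \<in> J" for s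
    unfolding c_def using that \<alpha> \<gamma>
    by (simp_all add: norm_orth_group gradient_solution_def image_subset_iff)
  define d where "d s = \<alpha> s - \<gamma> s" for s
  \<comment> \<open>Adding and subtracting \<gamma> X \<alpha> splits the difference of the
    quadratic terms into two products linear in d.\<close>
  define d' where "d' s = - (1/2) *\<^sub>R (d s ** X ** \<alpha> s + \<gamma> s ** X ** d s)" for s
  \<comment> \<open>Each of the two products contributes this C once; the factor one half in
    \<open>d'\<close> compensates for there being two.\<close>
  have "d t = 0"
  proof (rule zero_of_linear_growth[where C = "c * norm X * K\<^sup>2" and d' = d', OF J(1,2) _ _ _ J(3)])
    show "d 0 = 0" by (simp add: d_def init)
    fix s assume s: "s \<in> J"
    have "(d has_vector_derivative
        (1/2) *\<^sub>R (X\<^sup>\<dagger> - \<alpha> s ** X ** \<alpha> s) - (1/2) *\<^sub>R (X\<^sup>\<dagger> - \<gamma> s ** X ** \<gamma> s)) (at s within J)"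
      unfolding d_def using s \<alpha> \<gamma>
      by (intro has_vector_derivative_diff) (auto simp: gradient_solution_def)
    moreover have "(1/2) *\<^sub>R (X\<^sup>\<dagger> - \<alpha> s ** X ** \<alpha> s) - (1/2) *\<^sub>R (X\<^sup>\<dagger> - \<gamma> s ** X ** \<gamma> s) = d' s"
      by (simp add: d'_def d_def matrix_ring_simps flip: scaleR_diff_right scaleR_minus_right)
    ultimately show "(d has_vector_derivative d' s) (at s within J)" by simp
    have "norm (d s ** X ** \<alpha> s) \<le> c * norm X * K\<^sup>2 * norm (d s)"
      using K3[of "d s" X "\<alpha> s"] bound[OF s] by (simp add: mult_ac)
    moreover have "norm (\<gamma> s ** X ** d s) \<le> c * norm X * K\<^sup>2 * norm (d s)"
      using K3[of "\<gamma> s" X "d s"] bound[OF s] by (simp add: mult_ac)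
    ultimately have "norm (d s ** X ** \<alpha> s + \<gamma> s ** X ** d s) \<le> 2 * (c * norm X * K\<^sup>2 * norm (d s))"
      using norm_triangle_ineq[of "d s ** X ** \<alpha> s" "\<gamma> s ** X ** d s"]
      by simp
    then show "norm (d' s) \<le> c * norm X * K\<^sup>2 * norm (d s)"
      by (simp add: d'_def)
  qed
  then show ?thesis by (simp add: d_def)
qed

subsection \<open>Critical points and the Cayley transform\<close>

lemma orth_groupD:
  fixes A :: "'k::rch_algebra^'n^'n"
  assumes "A \<in> orth_group"
  shows "A ** A\<^sup>\<dagger> = mat 1" "A\<^sup>\<dagger> ** A = mat 1"
  using assms by (auto simp: orth_group_def intro: matrix_mult_eq_one_commute)

text \<open>The differential of the height function is the inner product with
  \<open>X\<^sup>\<dagger>\<close>. Tested on the tangent vector A W, where W = P* - P is skew and P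
  = X A, it shows that P* is orthogonal to W. Transposing, so is P, hence W is orthogonal to
  itself.\<close>

lemma critical_point_hermitian:
  fixes A X :: "'k::rch_algebra^'n^'n"
  assumes "critical_point (height X) A"
  shows "(X ** A)\<^sup>\<dagger> = X ** A"
proof -
  obtain D where A: "A \<in> orth_group" and D: "(height X has_derivative D) (at A)"
    and D0: "\<And>Y. Y \<in> tangent_space A \<Longrightarrow> D Y = 0"
    using assms by (auto simp: critical_point_def)
  have height: "height X = (\<lambda>B. inner (X\<^sup>\<dagger>) B)"
    by (simp add: height_def inner_eq_repart_trace fun_eq_iff)
  have "(height X has_derivative (\<lambda>B. inner (X\<^sup>\<dagger>) B)) (at A)"
    unfolding height by (intro bounded_linear_imp_has_derivative bounded_linear_inner_right)
  with D have D_eq: "D = (\<lambda>B. inner (X\<^sup>\<dagger>) B)"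
    by (rule has_derivative_unique)
  define P where "P = X ** A"
  define W where "W = P\<^sup>\<dagger> - P"
  have W: "W\<^sup>\<dagger> = - W"
    by (simp add: W_def ctranspose_simps)
  have "A ** W \<in> tangent_space A"
    using orth_groupD[OF A] W by (simp add: tangent_space_def ctranspose_mult matrix_mul_assoc)
      (simp flip: matrix_mul_assoc)
  then have "inner (X\<^sup>\<dagger>) (A ** W) = 0"
    using D0 D_eq by auto
  then have 1: "inner (P\<^sup>\<dagger>) W = 0"
    by (simp add: inner_matrix_adjoint P_def ctranspose_mult)
  have "inner P W = inner (P\<^sup>\<dagger>) (W\<^sup>\<dagger>)"
    by (simp add: inner_ctranspose)
  then have "inner P W = 0" using 1 W by simp
  with 1 have "inner W W = 0"
    by (metis W_def diff_0_right inner_diff_left)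
  then show ?thesis
    by (simp add: W_def P_def)
qed

text \<open>With S = A Y the denominator is A* (1 + S), whose inverse is R A. In the numerator 1 - S
  = 2 - (1 + S), so multiplying by R leaves 2 R - 1.\<close>

lemma cayley_ctranspose_skew:
  fixes A Y R :: "'k::rch_algebra^'n^'n"
  assumes A: "A \<in> orth_group" and R: "R ** (mat 1 + A ** Y) = mat 1"
    and skew: "(A ** Y)\<^sup>\<dagger> = - (A ** Y)"
  shows "Y \<in> Omega (A\<^sup>\<dagger>)" "cayley (A\<^sup>\<dagger>) Y = (2 *\<^sub>R R - mat 1) ** A"
    "2 *\<^sub>R R - mat 1 \<in> orth_group"
proof -
  define S where "S = A ** Y"
  note A = orth_groupD[OF A]
  have R': "(mat 1 + S) ** R = mat 1" "R ** (mat 1 + S) = mat 1"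
    using R by (auto simp: S_def intro: matrix_mult_eq_one_commute)
  have S: "S\<^sup>\<dagger> = - S" using skew by (simp add: S_def)
  have fac: "A\<^sup>\<dagger> + Y = A\<^sup>\<dagger> ** (mat 1 + S)"
    by (simp add: S_def matrix_ring_simps A)
  have "(A\<^sup>\<dagger> + Y) ** (R ** A) = A\<^sup>\<dagger> ** ((mat 1 + S) ** R) ** A"
    by (simp only: fac matrix_mul_assoc)
  then have inv: "(A\<^sup>\<dagger> + Y) ** (R ** A) = mat 1"
    by (simp add: R' A)
  then show "Y \<in> Omega (A\<^sup>\<dagger>)"
    unfolding Omega_def invertible_def using matrix_mult_eq_one_commute by blast
  have num: "(mat 1 - S) ** R = 2 *\<^sub>R R - mat 1"
    using R'(1) by (simp add: matrix_ring_simps algebra_simps scaleR_2)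
  show "cayley (A\<^sup>\<dagger>) Y = (2 *\<^sub>R R - mat 1) ** A"
    by (simp add: cayley_def matrix_inv_eqI[OF inv] matrix_mul_assoc flip: S_def num)
  \<comment> \<open>Exchanging these factors brings 1 - S next to its inverse, the adjoint of R, and
    1 + S next to R.\<close>
  have comm: "(mat 1 + S) ** (mat 1 - S) = (mat 1 - S) ** (mat 1 + S)"
    by (simp add: matrix_ring_simps)
  have "R\<^sup>\<dagger> ** (mat 1 - S) = ((mat 1 + S) ** R)\<^sup>\<dagger>"
    by (simp add: ctranspose_simps S)
  then have R_adj: "R\<^sup>\<dagger> ** (mat 1 - S) = mat 1" by (simp add: R')
  have "((mat 1 - S) ** R)\<^sup>\<dagger> ** ((mat 1 - S) ** R) = R\<^sup>\<dagger> ** ((mat 1 + S) ** (mat 1 - S)) ** R"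
    by (simp only: ctranspose_mult ctranspose_diff ctranspose_mat_one S minus_minus
        diff_minus_eq_add matrix_mul_assoc)
  also have "\<dots> = (R\<^sup>\<dagger> ** (mat 1 - S)) ** ((mat 1 + S) ** R)"
    by (simp only: comm matrix_mul_assoc)
  finally have "(2 *\<^sub>R R - mat 1)\<^sup>\<dagger> ** (2 *\<^sub>R R - mat 1) = mat 1"
    by (simp add: R_adj R' num)
  then show "2 *\<^sub>R R - mat 1 \<in> orth_group"
    by (auto simp: orth_group_def intro: matrix_mult_eq_one_commute)
qed

text \<open>Provides the initial value: the transform of a group element is tangent at A*, and the
  transform centered at A* undoes it. With T = A + Y and V its inverse, A c_A(Y) = (A - Y)
  V.\<close>

lemma cayley_orth_group_skew:
  fixes A Y :: "'k::rch_algebra^'n^'n"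
  assumes A: "A \<in> orth_group" and Y: "Y \<in> Omega_G A"
  shows "(A ** cayley A Y)\<^sup>\<dagger> = - (A ** cayley A Y)" "cayley (A\<^sup>\<dagger>) (cayley A Y) = Y"
proof -
  define T where "T = A + Y"
  define V where "V = matrix_inv T"
  note A = orth_groupD[OF A]
  have Y': "Y ** Y\<^sup>\<dagger> = mat 1" "Y\<^sup>\<dagger> ** Y = mat 1"
    using Y by (auto simp: Omega_G_def dest: orth_groupD)
  obtain V' where "T ** V' = mat 1"
    using Y by (auto simp: Omega_G_def Omega_def T_def invertible_def)
  then have V: "T ** V = mat 1"
    by (simp add: V_def matrix_inv_eqI)
  have V_adj: "V\<^sup>\<dagger> ** T\<^sup>\<dagger> = mat 1"
    using arg_cong[OF V, of ctranspose] by (simp add: ctranspose_mult)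
  have S: "A ** cayley A Y = (A - Y) ** V"
    by (simp add: cayley_def V_def T_def matrix_ring_simps A)
  \<comment> \<open>Both sides equal A* Y - Y* A, because A* A = Y* Y.\<close>
  have skew: "(A - Y)\<^sup>\<dagger> ** T = - (T\<^sup>\<dagger> ** (A - Y))"
    by (simp add: T_def ctranspose_simps matrix_ring_simps A Y')
  have "(A ** cayley A Y)\<^sup>\<dagger> = V\<^sup>\<dagger> ** ((A - Y)\<^sup>\<dagger> ** T) ** V"
    by (simp add: S ctranspose_mult V flip: matrix_mul_assoc)
  also have "\<dots> = - ((V\<^sup>\<dagger> ** T\<^sup>\<dagger>) ** (A - Y) ** V)"
    by (simp only: skew matrix_mult.minus_left matrix_mult.minus_right matrix_mul_assoc)
  finally show "(A ** cayley A Y)\<^sup>\<dagger> = - (A ** cayley A Y)"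
    by (simp add: S V_adj)
  have "mat 1 - A ** cayley A Y = T ** V - (A - Y) ** V"
    by (simp add: S V)
  then have num: "mat 1 - A ** cayley A Y = 2 *\<^sub>R (Y ** V)"
    by (simp add: T_def matrix_ring_simps scaleR_2)
  have "mat 1 + A ** cayley A Y = T ** V + (A - Y) ** V"
    by (simp add: S V)
  also have "\<dots> = 2 *\<^sub>R (A ** V)"
    by (simp add: T_def matrix_ring_simps scaleR_2)
  finally have den: "A\<^sup>\<dagger> ** (mat 1 + A ** cayley A Y) = 2 *\<^sub>R V"
    by (simp add: matrix_ring_simps A)
  then have "A\<^sup>\<dagger> + cayley A Y = 2 *\<^sub>R V"
    by (simp add: matrix_ring_simps A)
  moreover have "V ** T = mat 1"
    using V by (rule matrix_mult_eq_one_commute)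
  ultimately have "matrix_inv (A\<^sup>\<dagger> + cayley A Y) = (1/2) *\<^sub>R T"
    by (intro matrix_inv_eqI) (simp add: matrix_ring_simps)
  then show "cayley (A\<^sup>\<dagger>) (cayley A Y) = Y"
    using \<open>V ** T = mat 1\<close>
    by (simp add: cayley_def[of "A\<^sup>\<dagger>"] num matrix_mult.scaleR_left matrix_mult.scaleR_right
        flip: matrix_mul_assoc)
qed

text \<open>"The solution" is rendered as existence on the whole line together with uniqueness on
  every interval around the initial time. Membership in \<open>Omega\<close> ensures that
  \<open>cayley\<close> is evaluated only where it is meaningful.\<close>

theorem proposition4:
  fixes X A \<alpha>\<^sub>0 \<beta>\<^sub>0 :: "'k::rch_algebra^'n^'n" and \<beta> :: "real \<Rightarrow> 'k^'n^'n"
  assumes "A \<in> orth_group"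
    and "critical_point (height X) A"
    and "\<alpha>\<^sub>0 \<in> Omega_G A"
    and "\<beta>\<^sub>0 = cayley A \<alpha>\<^sub>0"
    and "\<And>t. \<beta> t = mat_exp ((- t / 2) *\<^sub>R (X ** A)) ** \<beta>\<^sub>0 ** mat_exp ((- t / 2) *\<^sub>R (A ** X))"
  shows "(\<forall>t. \<beta> t \<in> tangent_space (A\<^sup>\<dagger>) \<and> \<beta> t \<in> Omega (A\<^sup>\<dagger>)) \<and>
    gradient_solution X UNIV (cayley (A\<^sup>\<dagger>) \<circ> \<beta>) \<and> (cayley (A\<^sup>\<dagger>) \<circ> \<beta>) 0 = \<alpha>\<^sub>0 \<and>
    (\<forall>J \<alpha>. is_interval J \<and> 0 \<in> J \<and> gradient_solution X J \<alpha> \<and> \<alpha> 0 = \<alpha>\<^sub>0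
       \<longrightarrow> (\<forall>t\<in>J. \<alpha> t = cayley (A\<^sup>\<dagger>) (\<beta> t)))"
proof -
  note A = orth_groupD[OF assms(1)]
  define Q where "Q = A ** X"
  \<comment> \<open>Criticality makes X A Hermitian; conjugation by A carries this over to A
    X.\<close>
  have "Q = A ** (X ** A) ** A\<^sup>\<dagger>"
    by (simp add: Q_def A flip: matrix_mul_assoc)
  also have "\<dots> = A ** (X ** A)\<^sup>\<dagger> ** A\<^sup>\<dagger>"
    by (simp add: critical_point_hermitian[OF assms(2)])
  also have "\<dots> = Q\<^sup>\<dagger>"
    by (simp add: Q_def ctranspose_mult A matrix_mul_assoc)
  finally have Q: "Q\<^sup>\<dagger> = Q" by simp
  \<comment> \<open>With this, the gradient field at U A becomes (Q - U Q U) A / 2.\<close>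
  have X_adj: "X\<^sup>\<dagger> = Q ** A"
  proof -
    have "Q ** A = Q\<^sup>\<dagger> ** A" by (simp add: Q)
    also have "\<dots> = X\<^sup>\<dagger>" by (simp add: Q_def ctranspose_mult A flip: matrix_mul_assoc)
    finally show ?thesis by simp
  qed
  define M where "M = (- 1 / 2) *\<^sub>R Q"
  define E where "E t = mat_exp (t *\<^sub>R M)" for t
  define S where "S t = A ** \<beta> t" for t
  have E_adj: "(E t)\<^sup>\<dagger> = E t" for t
    by (simp add: E_def M_def ctranspose_mat_exp ctranspose_minus ctranspose_scaleR Q)
  \<comment> \<open>Moving A past the left exponential turns X A into A X, so both outer factors of
    S become the same E.\<close>
  have "A ** mat_exp ((- t / 2) *\<^sub>R (X ** A)) = E t ** A" for t
    unfolding E_def M_def Q_def by (rule mat_exp_intertwine) (simp add: matrix_ring_simps)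
  moreover have "E t = mat_exp ((- t / 2) *\<^sub>R (A ** X))" for t
    by (simp add: E_def M_def Q_def)
  ultimately have S_eq: "S t = E t ** (A ** \<beta>\<^sub>0) ** E t" for t
    by (simp add: S_def assms(5) matrix_mul_assoc)
  have skew0: "(A ** \<beta>\<^sub>0)\<^sup>\<dagger> = - (A ** \<beta>\<^sub>0)"
    using cayley_orth_group_skew(1)[OF assms(1,3)] by (simp add: assms(4))
  have S_skew: "(S t)\<^sup>\<dagger> = - S t" for t
    by (simp add: S_eq ctranspose_mult E_adj skew0[unfolded ctranspose_mult] matrix_ring_simps
        flip: matrix_mul_assoc)
  have "\<forall>t. \<exists>R. (mat 1 + S t) ** R = mat 1 \<and> R ** (mat 1 + S t) = mat 1"
    using S_skew by (meson skew_plus_one_inverse)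
  \<comment> \<open>The choice is pointwise and gives no regularity in t; differentiability follows
    below from the resolvent identity.\<close>
  then obtain R where R: "\<And>t. (mat 1 + S t) ** R t = mat 1" "\<And>t. R t ** (mat 1 + S t) = mat 1"
    by metis
  define U where "U t = 2 *\<^sub>R R t - mat 1" for t
  have cayley: "\<beta> t \<in> Omega (A\<^sup>\<dagger>)" "cayley (A\<^sup>\<dagger>) (\<beta> t) = U t ** A" "U t \<in> orth_group" for t
    using cayley_ctranspose_skew[OF assms(1), of "R t" "\<beta> t"] R(2)[of t] S_skew[of t]
    by (simp_all add: S_def U_def)
  \<comment> \<open>Tangency at A* reads S + S* = 0.\<close>
  have "\<beta> t \<in> tangent_space (A\<^sup>\<dagger>)" for t
    using S_skew[of t] by (simp add: tangent_space_def S_def ctranspose_mult)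
  have orth: "U t ** A \<in> orth_group" for t
  proof -
    have "(U t ** A) ** (U t ** A)\<^sup>\<dagger> = U t ** (A ** A\<^sup>\<dagger>) ** (U t)\<^sup>\<dagger>"
      by (simp only: ctranspose_mult matrix_mul_assoc)
    then show ?thesis
      using orth_groupD(1)[OF cayley(3)[of t]] by (simp add: A orth_group_def)
  qed
  have S': "(S has_vector_derivative M ** S t + S t ** M) (at t)" for t
  proof -
    have E': "(E has_vector_derivative M ** E t) (at t)"
      unfolding E_def by (rule mat_exp_has_vector_derivative)
    have "M ** E t = E t ** M"
      unfolding E_def by (rule mat_exp_intertwine) (simp add: matrix_ring_simps)
    moreover have "(S has_vector_derivative
        E t ** (A ** \<beta>\<^sub>0) ** (M ** E t) + (M ** E t ** (A ** \<beta>\<^sub>0)) ** E t) (at t)"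
      unfolding S_eq[abs_def]
      by (intro matrix_mult.has_vector_derivative E'
          bounded_linear.has_vector_derivative[OF matrix_mult.bounded_linear_left])
    ultimately show ?thesis
      by (simp add: S_eq matrix_mul_assoc add.commute)
  qed
  \<comment> \<open>2 R = U + 1 is a sum of two group elements, each of the norm of the
    identity.\<close>
  have R_bound: "norm (R t) \<le> norm (mat 1 :: 'k^'n^'n)" for t
  proof -
    have "2 *\<^sub>R R t = U t + mat 1" by (simp add: U_def)
    then have "norm (2 *\<^sub>R R t) \<le> norm (U t) + norm (mat 1 :: 'k^'n^'n)"
      by (simp add: norm_triangle_ineq)
    then show ?thesis by (simp add: norm_orth_group[OF cayley(3)])
  qed
  have R': "(R has_vector_derivative - (R t ** (M ** S t + S t ** M) ** R t)) (at t)" for t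
    by (rule resolvent_has_vector_derivative[OF S' R(2,1) R_bound])
  have velocity: "2 *\<^sub>R (- (R t ** (M ** S t + S t ** M) ** R t)) ** A =
      (1/2) *\<^sub>R (X\<^sup>\<dagger> - (U t ** A) ** X ** (U t ** A))" for t
  proof -
    \<comment> \<open>These relations eliminate S: twice R (Q S + S Q) R becomes 2 R Q + 2 Q R - 4 R
      Q R, which is Q - U Q U for U = 2 R - 1.\<close>
    have SR: "S t ** R t = mat 1 - R t" "R t ** S t = mat 1 - R t"
      using R[of t] by (simp_all add: matrix_ring_simps algebra_simps)
    have "R t ** (Q ** S t + S t ** Q) ** R t = R t ** Q ** (S t ** R t) + (R t ** S t) ** Q ** R t"
      by (simp add: matrix_ring_simps)
    also have "2 *\<^sub>R \<dots> = Q - U t ** Q ** U t"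
      unfolding SR by (simp add: U_def matrix_ring_simps algebra_simps scaleR_2)
    finally have "(1/2) *\<^sub>R (Q - U t ** Q ** U t) =
        (1/2) *\<^sub>R (2 *\<^sub>R (R t ** (Q ** S t + S t ** Q) ** R t))"
      by simp
    also have "\<dots> = 2 *\<^sub>R (- (R t ** (M ** S t + S t ** M) ** R t))"
      by (simp add: M_def matrix_ring_simps scaleR_add_right)
    finally have "2 *\<^sub>R (- (R t ** (M ** S t + S t ** M) ** R t)) = (1/2) *\<^sub>R (Q - U t ** Q ** U t)"
      by (rule sym)
    then show ?thesis
      by (simp add: X_adj Q_def matrix_ring_simps)
  qed
  have sol: "gradient_solution X UNIV (cayley (A\<^sup>\<dagger>) \<circ> \<beta>)"
  proof -
    have "((\<lambda>s. U s ** A) has_vector_derivative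
        2 *\<^sub>R (- (R t ** (M ** S t + S t ** M) ** R t)) ** A) (at t)" for t
      unfolding U_def has_vector_derivative_diff_const
      using has_vector_derivative_diff[OF bounded_linear.has_vector_derivative[OF
            bounded_linear_scaleR_right R'] has_vector_derivative_const]
      by (intro bounded_linear.has_vector_derivative[OF matrix_mult.bounded_linear_left])
        (simp add: has_vector_derivative_diff_const)
    from this[unfolded velocity] show ?thesis
      by (auto simp: gradient_solution_def o_def cayley(2) orth)
  qed
  \<comment> \<open>At time 0 both exponentials are the identity.\<close>
  moreover have init: "(cayley (A\<^sup>\<dagger>) \<circ> \<beta>) 0 = \<alpha>\<^sub>0"
    using cayley_orth_group_skew(2)[OF assms(1,3)] by (simp add: assms(4,5))
  moreover have "\<alpha> t = cayley (A\<^sup>\<dagger>) (\<beta> t)"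
    if "is_interval J" "0 \<in> J" "gradient_solution X J \<alpha>" "\<alpha> 0 = \<alpha>\<^sub>0" "t \<in> J" for J \<alpha> t
  proof -
    have "gradient_solution X J (cayley (A\<^sup>\<dagger>) \<circ> \<beta>)"
      using sol by (auto simp: gradient_solution_def intro: has_vector_derivative_at_within)
    then show ?thesis
      using gradient_solution_unique[OF that(1,2,5,3), of "cayley (A\<^sup>\<dagger>) \<circ> \<beta>"] init that(4) by simp
  qed
  ultimately show ?thesis
    using \<open>\<And>t. \<beta> t \<in> tangent_space (A\<^sup>\<dagger>)\<close> cayley(1) by blast
qed

end
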